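(* Let $e\in[0,1)$, and let $\mathcal C_1,\mathcal C_2$, $\Lambda_1,\Lambda_2$ and $\Lambda_{m_2}^{m_1}$, $(m_1,m_2)\in\Xi$, be parameters of the conservative spin-spin system as in the context. Define $\alpha_1,\alpha_2$ by $$\alpha_j \frac{\Lambda_j}{\mathcal C_j} = \frac{1}{(1-e)^2} \sum_{(m_1,m_2)\in \Xi }\left(\frac{m_j^2}{\mathcal C_j}+\frac{|m_1m_2|}{\sqrt{\mathcal C_1\mathcal C_2}}\right)\Lambda_{m_2}^{m_1},\qquad j=1,2,$$ and assume that $$1>\frac{1}{(1-e)^3}\max \left \{ \frac{\Lambda_1}{\mathcal C_1} (1 + \alpha_1) , \frac{\Lambda_2}{\mathcal C_2} (1 + \alpha_2) \right \}.$$ Then the Dirichlet problem $$\mathcal C \ddot \Theta +F(t,\Theta)=0,\qquad \Theta(0)=\Theta(\pi)=0,$$ has a unique solution $\Theta:[0,\pi]\to\mathbb R^2$ (denoted $\Theta^*(t)$).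
   Context: Orbit: for $e\in[0,1)$ the eccentric anomaly $u=u(t)$ is defined by Kepler's equation $t=u-e\sin u$. Put $r(t)/a=1-e\cos u(t)$ ($a>0$ is the semimajor axis; only the ratio $a/r$ matters), and let $f(t)$ be the continuous function with $f(0)=0$ and $\frac{r(t)}{a}\exp(i f(t))=\cos u(t)-e+i\sqrt{1-e^2}\,\sin u(t)$ (true anomaly). These are real analytic in $t$, $r$ is even and $2\pi$-periodic, $f$ is odd and $f(t+2\pi)=f(t)+2\pi$. Parameters: $\Xi=\{(m_1,m_2)\in\mathbb Z^2: |m_1|+|m_2|\le 2\}$; $\mathcal C_1,\mathcal C_2>0$ with $\mathcal C_1+\mathcal C_2=1$; $\Lambda_1,\Lambda_2>0$; and $\Lambda_{m_2}^{m_1}>0$ for $(m_1,m_2)\in\Xi$, with $\Lambda_{m_2}^{m_1}=\Lambda_{-m_2}^{-m_1}$. Conservative spin-spin system: $\mathcal C\ddot\Theta+F(t,\Theta)=0$ for $\Theta=(\Theta_1,\Theta_2)^{\mathsf T}\in\mathbb R^2$, where $\mathcal C=\operatorname{diag}(\mathcal C_1,\mathcal C_2)$ and $$F(t,\Theta)=\left(\frac{a}{r(t)}\right)^{3}\begin{pmatrix}\Lambda_1\sin\Theta_1\\ \Lambda_2\sin\Theta_2\end{pmatrix}+\left(\frac{a}{r(t)}\right)^{5}\sum_{(m_1,m_2)\in\Xi}\begin{pmatrix}m_1\\ m_2\end{pmatrix}\Lambda_{m_2}^{m_1}\sin(m_1\Theta_1+m_2\Theta_2)+2\ddot f(t)\begin{pmatrix}\mathcal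 C_1\\ \mathcal C_2\end{pmatrix}.$$ *)

theory Defs
  imports "HOL-Analysis.Analysis"
begin

definition ecc_anomaly :: "real \<Rightarrow> real \<Rightarrow> real" where
  "ecc_anomaly e t = (THE u. t = u - e * sin u)"

text \<open>Only the ratio of the radius to the semimajor axis enters the equations, so
  \<open>r_over_a\<close> stands for \<open>r(t)/a\<close> and no semimajor axis appears.\<close>

definition r_over_a :: "real \<Rightarrow> real \<Rightarrow> real" where
  "r_over_a e t = 1 - e * cos (ecc_anomaly e t)"

definition true_anomaly :: "real \<Rightarrow> real \<Rightarrow> real" where
  "true_anomaly e = (THE f. continuous_on UNIV f \<and> f 0 = 0 \<and>
     (\<forall>t. complex_of_real (r_over_a e t) * exp (\<i> * complex_of_real (f t)) =
        Complex (cos (ecc_anomaly e t) - e) (sqrt (1 - e\<^sup>2) * sin (ecc_anomaly e t))))"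

definition \<Xi> :: "(int \<times> int) set" where
  "\<Xi> = {(m\<^sub>1, m\<^sub>2). \<bar>m\<^sub>1\<bar> + \<bar>m\<^sub>2\<bar> \<le> 2}"

definition diag2 :: "real \<Rightarrow> real \<Rightarrow> real^2^2" where
  "diag2 c\<^sub>1 c\<^sub>2 = vector [vector [c\<^sub>1, 0], vector [0, c\<^sub>2]]"

text \<open>\<open>\<Lambda> m\<^sub>1 m\<^sub>2\<close> has the upper index first and the lower index second.\<close>

definition spin_spin_F ::
  "real \<Rightarrow> real \<Rightarrow> real \<Rightarrow> real \<Rightarrow> real \<Rightarrow> (int \<Rightarrow> int \<Rightarrow> real) \<Rightarrow> real \<Rightarrow> real^2 \<Rightarrow> real^2" where
  "spin_spin_F e C\<^sub>1 C\<^sub>2 \<Lambda>\<^sub>1 \<Lambda>\<^sub>2 \<Lambda> t \<Theta> =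
     (1 / r_over_a e t) ^ 3 *\<^sub>R vector [\<Lambda>\<^sub>1 * sin (\<Theta> $ 1), \<Lambda>\<^sub>2 * sin (\<Theta> $ 2)] +
     (1 / r_over_a e t) ^ 5 *\<^sub>R
       (\<Sum>(m\<^sub>1, m\<^sub>2)\<in>\<Xi>. (\<Lambda> m\<^sub>1 m\<^sub>2 * sin (of_int m\<^sub>1 * \<Theta> $ 1 + of_int m\<^sub>2 * \<Theta> $ 2)) *\<^sub>R
          vector [of_int m\<^sub>1, of_int m\<^sub>2]) +
     (2 * deriv (deriv (true_anomaly e)) t) *\<^sub>R vector [C\<^sub>1, C\<^sub>2]"

text \<open>Classical solutions on \<open>[0, \<pi>]\<close>, with one-sided derivatives at the endpoints. When \<open>M\<close> is
  invertible and \<open>G\<close> is continuous, the second derivative is automatically continuous.\<close>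

definition dirichlet_solution ::
  "real^2^2 \<Rightarrow> (real \<Rightarrow> real^2 \<Rightarrow> real^2) \<Rightarrow> (real \<Rightarrow> real^2) \<Rightarrow> bool" where
  "dirichlet_solution M G \<Theta> \<longleftrightarrow>
     (\<exists>\<Theta>' \<Theta>''. \<forall>t\<in>{0..pi}.
        (\<Theta> has_vector_derivative \<Theta>' t) (at t within {0..pi}) \<and>
        (\<Theta>' has_vector_derivative \<Theta>'' t) (at t within {0..pi}) \<and>
        M *v \<Theta>'' t + G t (\<Theta> t) = 0) \<and>
     \<Theta> 0 = 0 \<and> \<Theta> pi = 0"

text \<open>The two definite descriptions above are well defined for \<open>0 \<le> e < 1\<close>.\<close>

lemma kepler_lipschitz:
  fixes e u v :: real
  assumes "0 \<le> e" "e < 1"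
  shows "(1 - e) * \<bar>u - v\<bar> \<le> \<bar>(u - e * sin u) - (v - e * sin v)\<bar>"
proof -
  have "\<bar>sin u - sin v\<bar> \<le> \<bar>u - v\<bar>"
  proof -
    have "sin u - sin v = 2 * sin ((u - v) / 2) * cos ((u + v) / 2)"
      by (rule sin_diff_sin)
    then have "\<bar>sin u - sin v\<bar> = 2 * \<bar>sin ((u - v) / 2)\<bar> * \<bar>cos ((u + v) / 2)\<bar>"
      by (simp add: abs_mult)
    also have "\<dots> \<le> 2 * \<bar>(u - v) / 2\<bar> * 1"
      by (intro mult_mono abs_sin_x_le_abs_x) auto
    finally show ?thesis by simp
  qed
  then have "e * \<bar>sin u - sin v\<bar> \<le> e * \<bar>u - v\<bar>"
    using assms by (simp add: mult_left_mono)
  moreover have "e * \<bar>sin u - sin v\<bar> = \<bar>e * sin u - e * sin v\<bar>"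
    using assms by (simp add: abs_mult flip: right_diff_distrib)
  moreover have "(1 - e) * \<bar>u - v\<bar> = \<bar>u - v\<bar> - e * \<bar>u - v\<bar>"
    by (simp add: left_diff_distrib)
  ultimately show ?thesis by linarith
qed

lemma kepler_ex1:
  fixes e t :: real
  assumes "0 \<le> e" "e < 1"
  shows "\<exists>!u. t = u - e * sin u"
proof (rule ex_ex1I)
  have b: "\<bar>e * sin x\<bar> \<le> 1" for x
    using assms by (auto simp: abs_mult intro!: mult_le_one)
  have "\<exists>u\<ge>t - 1. u \<le> t + 1 \<and> u - e * sin u = t"
  proof (rule IVT')
    show "t - 1 - e * sin (t - 1) \<le> t" using b[of "t - 1"] by linarith
    show "t \<le> t + 1 - e * sin (t + 1)" using b[of "t + 1"] by linarith
  qed (auto intro!: continuous_intros)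
  then show "\<exists>u. t = u - e * sin u" by force
next
  fix u v assume "t = u - e * sin u" "t = v - e * sin v"
  then have "(1 - e) * \<bar>u - v\<bar> \<le> 0"
    using kepler_lipschitz[OF assms, of u v] by simp
  then show "u = v"
    using assms by (simp add: mult_le_0_iff)
qed

lemma ecc_anomaly_kepler:
  assumes "0 \<le> e" "e < 1"
  shows "t = ecc_anomaly e t - e * sin (ecc_anomaly e t)"
  unfolding ecc_anomaly_def by (rule theI'[OF kepler_ex1[OF assms]])

lemma ecc_anomaly_0:
  assumes "0 \<le> e" "e < 1"
  shows "ecc_anomaly e 0 = 0"
  unfolding ecc_anomaly_def
  by (rule the1_equality[OF kepler_ex1[OF assms]]) simp

lemma continuous_on_ecc_anomaly:
  assumes "0 \<le> e" "e < 1"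
  shows "continuous_on UNIV (ecc_anomaly e)"
proof -
  have "(1/(1-e))-lipschitz_on UNIV (ecc_anomaly e)"
  proof (rule lipschitz_onI)
    fix s t :: real
    have "(1 - e) * \<bar>ecc_anomaly e s - ecc_anomaly e t\<bar> \<le> \<bar>s - t\<bar>"
      using kepler_lipschitz[OF assms, of "ecc_anomaly e s" "ecc_anomaly e t"]
        ecc_anomaly_kepler[OF assms] by metis
    then show "dist (ecc_anomaly e s) (ecc_anomaly e t) \<le> 1 / (1 - e) * dist s t"
      using assms by (simp add: dist_real_def field_simps)
  qed (use assms in auto)
  then show ?thesis by (rule lipschitz_on_continuous_on)
qed

lemma r_over_a_pos:
  assumes "0 \<le> e" "e < 1"
  shows "r_over_a e t > 0"
proof -
  have "e * cos (ecc_anomaly e t) \<le> e * 1"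
    using assms by (intro mult_left_mono) auto
  then show ?thesis using assms by (simp add: r_over_a_def)
qed

lemma true_anomaly_ex1:
  assumes "0 \<le> e" "e < 1"
  shows "\<exists>!f. continuous_on UNIV f \<and> f 0 = 0 \<and>
     (\<forall>t. complex_of_real (r_over_a e t) * exp (\<i> * complex_of_real (f t)) =
        Complex (cos (ecc_anomaly e t) - e) (sqrt (1 - e\<^sup>2) * sin (ecc_anomaly e t)))"
    (is "\<exists>!f. ?P f")
proof (rule ex_ex1I)
  define s where "s = sqrt (1 - e\<^sup>2)"
  define \<beta> where "\<beta> = e / (1 + s)"
  have e2: "e\<^sup>2 < 1" using assms by (simp add: power_less_one_iff abs_square_less_1)
  have s: "s > 0" "s\<^sup>2 = 1 - e\<^sup>2" using e2 by (auto simp: s_def)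
  have \<beta>: "0 \<le> \<beta>" "\<beta> < 1" using assms s by (auto simp: \<beta>_def)
  have eb: "e * (1 + \<beta>\<^sup>2) = 2 * \<beta>" and sb: "s * (1 + \<beta>\<^sup>2) = 1 - \<beta>\<^sup>2"
  proof -
    have nz: "1 + s \<noteq> 0" using s by auto
    have es: "e\<^sup>2 = 1 - s\<^sup>2" using s by simp
    have bb: "\<beta>\<^sup>2 * (1 + s) = 1 - s"
    proof -
      have "\<beta>\<^sup>2 * (1 + s) = e\<^sup>2 / (1 + s)"
        using nz by (simp add: \<beta>_def power2_eq_square)
      also have "e\<^sup>2 = (1 - s) * (1 + s)" unfolding es by (simp add: algebra_simps power2_eq_square)
      finally show ?thesis using nz by simp
    qed
    have b: "\<beta> * (1 + s) = e" using nz by (simp add: \<beta>_def)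
    have "e * (1 + \<beta>\<^sup>2) = \<beta> * (1 + s + \<beta>\<^sup>2 * (1 + s))"
      by (simp add: b[symmetric] algebra_simps)
    then show "e * (1 + \<beta>\<^sup>2) = 2 * \<beta>" by (simp add: bb)
    show "s * (1 + \<beta>\<^sup>2) = 1 - \<beta>\<^sup>2" using bb by (simp add: algebra_simps)
  qed
  define f where "f = (\<lambda>t. ecc_anomaly e t +
    2 * arctan (\<beta> * sin (ecc_anomaly e t) / (1 - \<beta> * cos (ecc_anomaly e t))))"
  have pos: "1 - \<beta> * cos x > 0" for x
  proof -
    have "\<beta> * cos x \<le> \<beta> * 1" using \<beta> by (intro mult_left_mono) auto
    then show ?thesis using \<beta> by simp
  qed
  have "continuous_on UNIV f"
    unfolding f_def using pos
    by (intro continuous_intros continuous_on_ecc_anomaly assms) (metis less_irrefl)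
  moreover have "f 0 = 0" by (simp add: f_def ecc_anomaly_0[OF assms])
  moreover have "complex_of_real (r_over_a e t) * exp (\<i> * complex_of_real (f t)) =
        Complex (cos (ecc_anomaly e t) - e) (s * sin (ecc_anomaly e t))" for t
  proof -
    define u where "u = ecc_anomaly e t"
    define c where "c = cos u"
    define d where "d = sin u"
    define p where "p = 1 - \<beta> * c"
    define q where "q = \<beta> * d"
    have cd: "c\<^sup>2 + d\<^sup>2 = 1" by (simp add: c_def d_def)
    have p: "p > 0" using pos by (simp add: p_def c_def)
    have pq: "p\<^sup>2 + q\<^sup>2 = (1 + \<beta>\<^sup>2) * (1 - e * c)"
    proof -
      have "p\<^sup>2 + q\<^sup>2 = 1 - 2 * \<beta> * c + \<beta>\<^sup>2 * (c\<^sup>2 + d\<^sup>2)"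
        by (simp add: p_def q_def power2_eq_square algebra_simps)
      also have "\<dots> = 1 + \<beta>\<^sup>2 - (e * (1 + \<beta>\<^sup>2)) * c" by (simp add: cd eb)
      finally show ?thesis by (simp add: algebra_simps)
    qed
    have pq0: "p\<^sup>2 + q\<^sup>2 > 0" using p by (simp add: add_pos_nonneg)
    have bp: "1 + \<beta>\<^sup>2 > 0" by (simp add: add_pos_nonneg)
    define w where "w = arctan (q / p)"
    have sq: "1 + (q/p)\<^sup>2 = (p\<^sup>2 + q\<^sup>2) / p\<^sup>2" using p by (simp add: field_simps)
    have w2: "(cos w)\<^sup>2 = p\<^sup>2 / (p\<^sup>2 + q\<^sup>2)"
    proof -
      have "(cos w)\<^sup>2 = 1 / (sqrt (1 + (q / p)\<^sup>2))\<^sup>2"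
        unfolding w_def cos_arctan by (simp add: power_one_over)
      also have "(sqrt (1 + (q / p)\<^sup>2))\<^sup>2 = 1 + (q / p)\<^sup>2"
        by (rule real_sqrt_pow2) (intro add_nonneg_nonneg; simp)
      finally show ?thesis unfolding sq by simp
    qed
    have tw: "sin w = (q / p) * cos w"
      using tan_arctan[of "q/p"] cos_arctan_not_zero[of "q/p"]
      by (simp add: w_def tan_def field_simps)
    have c2w: "cos (2 * w) = (p\<^sup>2 - q\<^sup>2) / (p\<^sup>2 + q\<^sup>2)"
    proof -
      have "cos (2 * w) = (cos w)\<^sup>2 - (q / p)\<^sup>2 * (cos w)\<^sup>2"
        unfolding cos_double tw power_mult_distrib by simp
      also have "\<dots> = (p\<^sup>2 - q\<^sup>2) / (p\<^sup>2 + q\<^sup>2)"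
        using p pq0 by (simp add: w2 power_divide diff_divide_distrib)
      finally show ?thesis .
    qed
    have s2w: "sin (2 * w) = 2 * p * q / (p\<^sup>2 + q\<^sup>2)"
    proof -
      have "sin (2 * w) = 2 * (q / p) * (cos w)\<^sup>2"
        by (simp add: sin_double tw power2_eq_square)
      also have "\<dots> = 2 * p * q / (p\<^sup>2 + q\<^sup>2)"
        unfolding w2 using p by (simp add: power2_eq_square)
      finally show ?thesis .
    qed
    have ft: "f t = u + 2 * w"
      by (simp add: f_def u_def w_def p_def q_def c_def d_def)
    have rt: "r_over_a e t = (p\<^sup>2 + q\<^sup>2) / (1 + \<beta>\<^sup>2)"
      using bp by (simp add: pq r_over_a_def c_def u_def)
    have collect: "N / b * (x * (A / N) + y * (B / N)) = (x * A + y * B) / b"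
      if "N \<noteq> 0" for N b x y A B :: real
      using that by (simp add: distrib_left add_divide_distrib)
    have dd: "d\<^sup>2 = 1 - c\<^sup>2" using cd by simp
    have R: "r_over_a e t * cos (f t) = c - e"
    proof -
      have "r_over_a e t * cos (f t) = (c * (p\<^sup>2 - q\<^sup>2) - d * (2 * p * q)) / (1 + \<beta>\<^sup>2)"
        unfolding ft cos_add c2w s2w rt using pq0
        by (simp add: c_def[symmetric] d_def[symmetric] diff_divide_distrib right_diff_distrib)
      also have "c * (p\<^sup>2 - q\<^sup>2) - d * (2 * p * q) = (1 + \<beta>\<^sup>2) * c - 2 * \<beta>"
      proof -
        have "c * (p\<^sup>2 - q\<^sup>2) - d * (2 * p * q) =
          c * (1 - \<beta> * c)\<^sup>2 - c * \<beta>\<^sup>2 * d\<^sup>2 - 2 * \<beta> * (1 - \<beta> * c) * d\<^sup>2"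
          by (simp add: p_def q_def power2_eq_square algebra_simps)
        then show ?thesis unfolding dd by (simp add: power2_eq_square algebra_simps)
      qed
      also have "\<dots> = (1 + \<beta>\<^sup>2) * (c - e)" using eb by (simp add: algebra_simps)
      finally show ?thesis using bp by simp
    qed
    have I: "r_over_a e t * sin (f t) = s * d"
    proof -
      have "r_over_a e t * sin (f t) = (d * (p\<^sup>2 - q\<^sup>2) + c * (2 * p * q)) / (1 + \<beta>\<^sup>2)"
        unfolding ft sin_add c2w s2w rt c_def[symmetric] d_def[symmetric]
        using collect[of "p\<^sup>2 + q\<^sup>2"] pq0 by (metis less_irrefl)
      also have "d * (p\<^sup>2 - q\<^sup>2) + c * (2 * p * q) = d * (1 - \<beta>\<^sup>2)"
      proof -
        have "d * (p\<^sup>2 - q\<^sup>2) + c * (2 * p * q) =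
          d * ((1 - \<beta> * c)\<^sup>2 - \<beta>\<^sup>2 * d\<^sup>2 + 2 * c * \<beta> * (1 - \<beta> * c))"
          by (simp add: p_def q_def power2_eq_square algebra_simps)
        then show ?thesis unfolding dd by (simp add: power2_eq_square algebra_simps)
      qed
      also have "\<dots> = (1 + \<beta>\<^sup>2) * (s * d)" unfolding sb[symmetric] by (simp add: algebra_simps)
      finally show ?thesis using bp by simp
    qed
    show ?thesis
      using R I by (simp add: complex_eq_iff cis_conv_exp[symmetric] c_def d_def u_def)
  qed
  ultimately show "\<exists>f. ?P f" unfolding s_def by blast
next
  fix f g assume f: "?P f" and g: "?P g"
  have "exp (\<i> * complex_of_real (f t)) = exp (\<i> * complex_of_real (g t))" for t
    using f g r_over_a_pos[OF assms, of t] by (metis less_irrefl mult_left_cancel of_real_eq_0_iff)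
  then have "cis (f t - g t) = 1" for t
    by (simp add: cis_conv_exp right_diff_distrib exp_diff)
  then have *: "cos (f t - g t) = 1" for t
    by (metis cis.sel(1) one_complex.sel(1))
  have "(\<lambda>t. (f t - g t) / (2 * pi)) constant_on UNIV"
  proof (rule continuous_discrete_range_constant)
    show "continuous_on UNIV (\<lambda>t. (f t - g t) / (2 * pi))"
      using f g by (intro continuous_intros) auto
  next
    fix x :: real
    have int: "\<exists>n::int. (f t - g t) / (2 * pi) = of_int n" for t
      using *[of t] by (auto simp: cos_one_2pi_int field_simps)
    have "1 \<le> norm ((f y - g y) / (2 * pi) - (f x - g x) / (2 * pi))"
      if "(f y - g y) / (2 * pi) \<noteq> (f x - g x) / (2 * pi)" for y
    proof -
      obtain m n :: int where mn: "(f y - g y) / (2 * pi) = of_int m" "(f x - g x) / (2 * pi) = of_int n"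
        using int by metis
      then have "1 \<le> \<bar>m - n\<bar>" using that by auto
      then have "(1::real) \<le> of_int \<bar>m - n\<bar>" by linarith
      then show ?thesis unfolding mn by simp
    qed
    then show "\<exists>k>0. \<forall>y. y \<in> UNIV \<and> (f y - g y) / (2 * pi) \<noteq> (f x - g x) / (2 * pi) \<longrightarrow>
        k \<le> norm ((f y - g y) / (2 * pi) - (f x - g x) / (2 * pi))"
      by (intro exI[of _ 1]) auto
  qed auto
  then obtain k where "(f t - g t) / (2 * pi) = k" for t
    unfolding constant_on_def by blast
  then have "(f t - g t) / (2 * pi) = (f 0 - g 0) / (2 * pi)" for t by metis
  then show "f = g" using f g by (intro ext) (simp)
qed

end

theory Submission
  imports Defs
begin

text \<open>In the variables \<open>\<surd>C\<^sub>j \<Theta>\<^sub>j\<close> the Jacobian of the force is \<open>C\<^sup>-\<^sup>1\<^sup>/\<^sup>2 (\<partial>F/\<partial>\<Theta>) C\<^sup>-\<^sup>1\<^sup>/\<^sup>2\<close>, and since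
  \<open>r/a \<ge> 1 - e\<close> the absolute sums of its two rows are at most \<open>(1 - e)\<^sup>-\<^sup>3 \<Lambda>\<^sub>j (1 + \<alpha>\<^sub>j) / C\<^sub>j\<close>. By
  hypothesis the force is thus Lipschitz in the maximum norm with a constant \<open>K < 1\<close>, below the first
  Dirichlet eigenvalue \<open>1\<close> of \<open>-d\<^sup>2/dt\<^sup>2\<close> on \<open>[0, \<pi>]\<close>. The maximum principle, applied with a positive
  function satisfying \<open>-\<phi>'' = l\<^sup>2 \<phi>\<close> for some \<open>K < l\<^sup>2 < 1\<close>, makes the solution operator of the linear
  problem a contraction, and Picard iteration gives existence and uniqueness.\<close>

section \<open>The linear Dirichlet problem on \<open>[0, \<pi>]\<close>\<close>

text \<open>The one-dimensional maximum principle. A negative value at an interior point forces, by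
  the mean value theorem, a negative slope at some \<open>p\<close> to its left and a positive slope
  at some \<open>q\<close> to its right; one more use, on \<open>v'\<close>, finds an
  \<open>s\<close> between them with \<open>v'' s > 0\<close>.\<close>

lemma nonneg_if_second_derivative_nonpos:
  fixes v v' v'' :: "real \<Rightarrow> real"
  assumes v: "\<And>t. t \<in> {a..b} \<Longrightarrow> (v has_vector_derivative v' t) (at t within {a..b})"
    and v': "\<And>t. t \<in> {a..b} \<Longrightarrow> (v' has_vector_derivative v'' t) (at t within {a..b})"
    and v'': "\<And>t. t \<in> {a..b} \<Longrightarrow> v'' t \<le> 0"
    and "0 \<le> v a" "0 \<le> v b" and t: "t \<in> {a..b}"
  shows "0 \<le> v t"
proof (rule ccontr)
  assume neg: "\<not> 0 \<le> v t"
  have ab: "a < t" "t < b" using assms(4,5) t neg by (auto simp: order.order_iff_strict)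
  have mvt: "\<exists>z. x < z \<and> z < y \<and> f y - f x = (y - x) * f' z"
    if xy: "x < y" "a \<le> x" "y \<le> b"
      and f: "\<And>t. t \<in> {a..b} \<Longrightarrow> (f has_vector_derivative f' t) (at t within {a..b})"
    for x y and f f' :: "real \<Rightarrow> real"
  proof -
    have "\<exists>z\<in>{x<..<y}. f y - f x = (\<lambda>h. h * f' z) (y - x)"
    proof (rule mvt_simple[OF xy(1)])
      fix z assume "x \<le> z" "z \<le> y"
      then have "(f has_vector_derivative f' z) (at z within {x..y})"
        using f[of z] xy by (auto intro: has_vector_derivative_within_subset)
      then show "(f has_derivative (\<lambda>h. h * f' z)) (at z within {x..y})"
        by (simp add: has_vector_derivative_def)
    qed
    then show ?thesis by auto
  qed
  obtain p where p: "a < p" "p < t" "v t - v a = (t - a) * v' p"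
    using mvt[OF ab(1) _ _ v] ab by auto
  obtain q where q: "t < q" "q < b" "v b - v t = (b - t) * v' q"
    using mvt[OF ab(2) _ _ v] ab by auto
  obtain s where s: "p < s" "s < q" "v' q - v' p = (q - p) * v'' s"
    using mvt[of p q, OF _ _ _ v'] p q by auto
  have "(t - a) * v' p < 0" "(b - t) * v' q > 0"
    using p q neg assms(4,5) by linarith+
  then have "v' p < 0" "0 < v' q" using ab by (auto simp: mult_less_0_iff zero_less_mult_iff)
  moreover have "(q - p) * v'' s \<le> 0"
    using v''[of s] s p q by (intro mult_nonneg_nonpos) auto
  ultimately show False using s by linarith
qed

text \<open>A solution of \<open>y'' = - l\<^sup>2 * y\<close>. Centring the cosine at the midpoint
  of the interval keeps it positive up to both endpoints when \<open>0 < l < 1\<close>.\<close>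

definition weight :: "real \<Rightarrow> real \<Rightarrow> real" where
  "weight l t = cos (l * (t - pi / 2))"

text \<open>On the interval the argument of the cosine has modulus at most
  \<open>l * (pi / 2) < pi / 2\<close>, so the endpoint value is a positive minimum.\<close>

lemma weight_lower_bound:
  assumes "0 < l" "l < 1"
  shows "\<exists>c>0. \<forall>t\<in>{0..pi}. c \<le> weight l t"
proof (intro exI conjI ballI)
  show "0 < cos (l * (pi / 2))"
    using assms by (intro cos_gt_zero_pi) (auto intro: less_le_trans[of _ 0])
  fix t :: real assume t: "t \<in> {0..pi}"
  have "\<bar>t - pi / 2\<bar> \<le> pi / 2" using t unfolding abs_le_iff by auto
  then have "l * \<bar>t - pi / 2\<bar> \<le> l * (pi / 2)" using assms by (intro mult_left_mono) auto
  moreover have "l * (pi / 2) \<le> pi" using assms mult_right_mono[of l 1 "pi/2"] by simp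
  ultimately have "cos (l * (pi / 2)) \<le> cos (l * \<bar>t - pi / 2\<bar>)"
    using assms by (intro cos_monotone_0_pi_le) auto
  also have "\<dots> = cos \<bar>l * (t - pi / 2)\<bar>" using assms by (simp add: abs_mult)
  also have "\<dots> = weight l t" by (simp add: weight_def)
  finally show "cos (l * (pi / 2)) \<le> weight l t" .
qed

text \<open>Both \<open>D * weight l - u\<close> and \<open>D * weight l + u\<close> are concave
  with nonnegative endpoint values, so the maximum principle applies. In operator terms, solving the
  linear Dirichlet problem has norm at most \<open>1 / l\<^sup>2\<close> for the supremum norm
  weighted by \<open>weight l\<close>.\<close>

lemma dirichlet_comparison:
  fixes u u' u'' :: "real \<Rightarrow> real"
  assumes l: "0 < l" "l < 1"
    and u: "\<And>t. t \<in> {0..pi} \<Longrightarrow> (u has_vector_derivative u' t) (at t within {0..pi})"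
    and u': "\<And>t. t \<in> {0..pi} \<Longrightarrow> (u' has_vector_derivative u'' t) (at t within {0..pi})"
    and bd: "u 0 = 0" "u pi = 0"
    and u'': "\<And>t. t \<in> {0..pi} \<Longrightarrow> \<bar>u'' t\<bar> \<le> l\<^sup>2 * D * weight l t"
    and t: "t \<in> {0..pi}"
  shows "\<bar>u t\<bar> \<le> D * weight l t"
proof -
  obtain c where c: "c > 0" "\<And>t. t \<in> {0..pi} \<Longrightarrow> c \<le> weight l t"
    using weight_lower_bound[OF l] by auto
  have wpos: "weight l t > 0" if "t \<in> {0..pi}" for t using c that by force
  \<comment> \<open>The bound on \<open>u''\<close> at a single point, where the weight is positive,
    already forces \<open>D\<close> to be nonnegative.\<close>
  have "0 \<le> l\<^sup>2 * D * weight l 0" using u''[of 0] by simp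
  then have D: "0 \<le> D" using wpos[of 0] l by (simp add: zero_le_mult_iff)
  have key: "0 \<le> D * weight l t - s * u t" if s: "\<bar>s\<bar> = 1" for s :: real
  proof (rule nonneg_if_second_derivative_nonpos[OF _ _ _ _ _ t])
    fix t :: real assume t: "t \<in> {0..pi}"
    show "((\<lambda>t. D * weight l t - s * u t) has_vector_derivative
        (- D * l * sin (l * (t - pi / 2)) - s * u' t)) (at t within {0..pi})"
      unfolding weight_def
      by (rule derivative_eq_intros u[OF t, unfolded has_real_derivative_iff_has_vector_derivative[symmetric]]
          refl | simp add: has_real_derivative_iff_has_vector_derivative[symmetric])+
    show "((\<lambda>t. - D * l * sin (l * (t - pi / 2)) - s * u' t) has_vector_derivative
        (- D * l\<^sup>2 * weight l t - s * u'' t)) (at t within {0..pi})"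
      unfolding weight_def power2_eq_square
      by (rule derivative_eq_intros u'[OF t, unfolded has_real_derivative_iff_has_vector_derivative[symmetric]]
          refl | simp add: has_real_derivative_iff_has_vector_derivative[symmetric])+
    have "\<bar>s * u'' t\<bar> \<le> l\<^sup>2 * D * weight l t" using u''[OF t] s by (simp add: abs_mult)
    then show "- D * l\<^sup>2 * weight l t - s * u'' t \<le> 0" by (simp add: abs_le_iff algebra_simps)
  qed (use D wpos[of 0] wpos[of pi] bd in auto)
  show ?thesis using key[of 1] key[of "-1"] by (simp add: abs_le_iff)
qed

text \<open>A solution of the nonlinear problem is a fixed point of the linear solution operator; in
  this form two solutions can be fed to \<open>dirichlet_contraction\<close>.\<close>

lemma dirichlet_solution_frozen:
  "dirichlet_solution M G x \<longleftrightarrow> dirichlet_solution M (\<lambda>t _. G t (x t)) x"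
  by (simp add: dirichlet_solution_def)

lemma dirichlet_solution_cong:
  assumes "\<And>t. t \<in> {0..pi} \<Longrightarrow> G t (x t) = H t (x t)"
  shows "dirichlet_solution M G x \<longleftrightarrow> dirichlet_solution M H x"
  unfolding dirichlet_solution_def
  by (intro conj_cong ex_cong1 ball_cong refl) (simp_all add: assms)

lemma dirichlet_solution_continuous:
  "dirichlet_solution M G x \<Longrightarrow> continuous_on {0..pi} x"
  unfolding dirichlet_solution_def continuous_on_eq_continuous_within
  by (blast dest: has_vector_derivative_continuous)

text \<open>Integrate \<open>h\<close> twice, then add the linear function whose slope
  \<open>c\<close> restores the boundary value at \<open>pi\<close>.\<close>

lemma dirichlet_linear_exists:
  fixes h :: "real \<Rightarrow> real^2"
  assumes h: "continuous_on {0..pi} h"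
  shows "\<exists>x. dirichlet_solution (mat 1) (\<lambda>t _. h t) x"
proof -
  define H where "H t = integral {0..t} h" for t
  define J where "J t = integral {0..t} H" for t
  have H: "(H has_vector_derivative h t) (at t within {0..pi})" if "t \<in> {0..pi}" for t
    unfolding H_def by (rule integral_has_vector_derivative[OF h that])
  have "continuous_on {0..pi} H"
    unfolding continuous_on_eq_continuous_within by (blast dest: H has_vector_derivative_continuous)
  then have J: "(J has_vector_derivative H t) (at t within {0..pi})" if "t \<in> {0..pi}" for t
    unfolding J_def by (rule integral_has_vector_derivative[OF _ that])
  define c where "c = (1 / pi) *\<^sub>R J pi"
  have "dirichlet_solution (mat 1) (\<lambda>t _. h t) (\<lambda>t. t *\<^sub>R c - J t)"
    unfolding dirichlet_solution_def
  proof (intro conjI exI ballI)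
    fix t :: real assume t: "t \<in> {0..pi}"
    show "((\<lambda>t. t *\<^sub>R c - J t) has_vector_derivative c - H t) (at t within {0..pi})"
      by (rule derivative_eq_intros J[OF t] refl | simp)+
    show "((\<lambda>t. c - H t) has_vector_derivative - h t) (at t within {0..pi})"
      by (rule derivative_eq_intros H[OF t] refl | simp)+
    show "mat 1 *v - h t + h t = 0" by simp
  qed (simp_all add: J_def c_def)
  then show ?thesis by blast
qed

section \<open>The nonlinear Dirichlet problem below the first eigenvalue\<close>

text \<open>The solution operator sends \<open>a\<close> to \<open>x\<close> and \<open>b\<close> to
  \<open>y\<close>. Each component of \<open>x - y\<close> solves a scalar linear problem with
  second derivative at most \<open>K * D * weight l\<close>, so \<open>dirichlet_comparison\<close>
  applies with the constant \<open>K / l\<^sup>2 * D\<close>. Quantifying over \<open>D\<close> in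
  \<open>lip\<close> expresses a Lipschitz bound in the weighted maximum norm without writing a
  maximum.\<close>

lemma dirichlet_contraction:
  fixes g :: "real \<Rightarrow> real^2 \<Rightarrow> real^2" and w :: "2 \<Rightarrow> real"
  assumes l: "0 < l" "l < 1" and w: "\<And>i. w i > 0"
    and lip: "\<And>t x y D j. t \<in> {0..pi} \<Longrightarrow> (\<And>i. w i * \<bar>x $ i - y $ i\<bar> \<le> D) \<Longrightarrow>
      w j * \<bar>g t x $ j - g t y $ j\<bar> \<le> K * D"
    and x: "dirichlet_solution (mat 1) (\<lambda>t _. g t (a t)) x"
    and y: "dirichlet_solution (mat 1) (\<lambda>t _. g t (b t)) y"
    and ab: "\<And>t i. t \<in> {0..pi} \<Longrightarrow> w i * \<bar>a t $ i - b t $ i\<bar> \<le> D * weight l t"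
    and t: "t \<in> {0..pi}"
  shows "w j * \<bar>x t $ j - y t $ j\<bar> \<le> (K / l\<^sup>2) * D * weight l t"
proof -
  obtain x' x'' where x':
    "\<And>t. t \<in> {0..pi} \<Longrightarrow> (x has_vector_derivative x' t) (at t within {0..pi})"
    "\<And>t. t \<in> {0..pi} \<Longrightarrow> (x' has_vector_derivative x'' t) (at t within {0..pi})"
    "\<And>t. t \<in> {0..pi} \<Longrightarrow> x'' t = - g t (a t)" "x 0 = 0" "x pi = 0"
    using x unfolding dirichlet_solution_def add_eq_0_iff2 matrix_vector_mul_lid by blast
  obtain y' y'' where y':
    "\<And>t. t \<in> {0..pi} \<Longrightarrow> (y has_vector_derivative y' t) (at t within {0..pi})"
    "\<And>t. t \<in> {0..pi} \<Longrightarrow> (y' has_vector_derivative y'' t) (at t within {0..pi})"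
    "\<And>t. t \<in> {0..pi} \<Longrightarrow> y'' t = - g t (b t)" "y 0 = 0" "y pi = 0"
    using y unfolding dirichlet_solution_def add_eq_0_iff2 matrix_vector_mul_lid by blast
  have bl: "bounded_linear (\<lambda>z::real^2. w j * (z $ j))"
    by (intro bounded_linear_const_mult bounded_linear_vec_nth)
  note comp = bounded_linear.has_vector_derivative[OF bl]
  have "\<bar>w j * ((x t - y t) $ j)\<bar> \<le> (K / l\<^sup>2 * D) * weight l t"
  proof (rule dirichlet_comparison[OF l _ _ _ _ _ t])
    fix t :: real assume t: "t \<in> {0..pi}"
    show "((\<lambda>t. w j * ((x t - y t) $ j)) has_vector_derivative w j * ((x' t - y' t) $ j))
      (at t within {0..pi})"
      by (rule comp) (intro derivative_intros x' y' t)
    show "((\<lambda>t. w j * ((x' t - y' t) $ j)) has_vector_derivative w j * ((x'' t - y'' t) $ j))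
      (at t within {0..pi})"
      by (rule comp) (intro derivative_intros x' y' t)
    have "w j * \<bar>g t (a t) $ j - g t (b t) $ j\<bar> \<le> K * (D * weight l t)"
      by (rule lip[OF t]) (rule ab[OF t])
    moreover have "\<bar>w j * ((x'' t - y'' t) $ j)\<bar> = w j * \<bar>g t (a t) $ j - g t (b t) $ j\<bar>"
      using x'(3)[OF t] y'(3)[OF t] w[of j] by (simp add: abs_mult abs_minus_commute)
    ultimately show "\<bar>w j * ((x'' t - y'' t) $ j)\<bar> \<le> l\<^sup>2 * (K / l\<^sup>2 * D) * weight l t"
      using l by simp
  qed (simp_all add: x' y')
  then show ?thesis using w[of j] by (simp add: abs_mult)
qed

text \<open>The weight \<open>weight l\<close> replaces the first eigenfunction \<open>sin\<close>: it is bounded away from zero, so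
  the weighted norm is equivalent to the supremum norm, and since \<open>K < l\<^sup>2\<close> the solution operator
  still contracts by the factor \<open>K / l\<^sup>2\<close>.\<close>

theorem dirichlet_unique_solution:
  fixes g :: "real \<Rightarrow> real^2 \<Rightarrow> real^2" and w :: "2 \<Rightarrow> real"
  assumes cont: "continuous_on ({0..pi} \<times> UNIV) (\<lambda>(t, x). g t x)"
    and w: "\<And>i. w i > 0" and K: "0 \<le> K" "K < 1"
    and lip: "\<And>t x y D j. t \<in> {0..pi} \<Longrightarrow> (\<And>i. w i * \<bar>x $ i - y $ i\<bar> \<le> D) \<Longrightarrow>
      w j * \<bar>g t x $ j - g t y $ j\<bar> \<le> K * D"
  shows "\<exists>x. dirichlet_solution (mat 1) g x \<and>
    (\<forall>y. dirichlet_solution (mat 1) g y \<longrightarrow> (\<forall>t\<in>{0..pi}. y t = x t))"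
proof -
  \<comment> \<open>The midpoint of \<open>K\<close> and 1 serves as \<open>l\<^sup>2\<close>, so
    that \<open>K < l\<^sup>2 < 1\<close>.\<close>
  define l where "l = sqrt ((1 + K) / 2)"
  have l: "0 < l" "l < 1" using K by (auto simp: l_def)
  have l2: "l\<^sup>2 = (1 + K) / 2" using K by (simp add: l_def)
  define q where "q = K / l\<^sup>2"
  have q: "0 \<le> q" "q < 1" using K by (auto simp: q_def l2)
  note contr = dirichlet_contraction[where g=g, OF l w lip, folded q_def]
  obtain c where c: "c > 0" "\<And>t. t \<in> {0..pi} \<Longrightarrow> c \<le> weight l t"
    using weight_lower_bound[OF l] by auto
  have wle: "weight l t \<le> 1" for t by (simp add: weight_def)
  \<comment> \<open>Continuous functions have finite weighted distance: their difference is bounded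
    on the compact interval and the weight is at least \<open>c\<close>. \<open>W\<close> is merely
    a common upper bound of the \<open>w i\<close>.\<close>
  have weighted_bound: "\<exists>D\<ge>0. \<forall>t\<in>{0..pi}. \<forall>i. w i * \<bar>x t $ i - y t $ i\<bar> \<le> D * weight l t"
    if x: "continuous_on {0..pi} x" and y: "continuous_on {0..pi} y" for x y :: "real \<Rightarrow> real^2"
  proof -
    have "compact ((\<lambda>t. x t - y t) ` {0..pi})"
      by (intro compact_continuous_image continuous_intros x y) auto
    then obtain B where B: "B > 0" "\<And>t. t \<in> {0..pi} \<Longrightarrow> norm (x t - y t) \<le> B"
      using bounded_pos[of "(\<lambda>t. x t - y t) ` {0..pi}"] compact_imp_bounded by auto
    define W where "W = (\<Sum>i\<in>UNIV. w i)"
    have W: "w i \<le> W" for i unfolding W_def using w less_imp_le by (intro member_le_sum) auto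
    show ?thesis
    proof (intro exI[of _ "W * B / c"] conjI ballI allI)
      show "0 \<le> W * B / c" using W[of 1] w[of 1] B c by auto
      fix t :: real and i assume t: "t \<in> {0..pi}"
      have "w i * \<bar>(x t - y t) $ i\<bar> \<le> W * B"
        using W[of i] w[of i] B(2)[OF t] component_le_norm_cart[of "x t - y t" i]
        by (intro mult_mono) auto
      also have "\<dots> = W * B / c * c" using c by simp
      also have "\<dots> \<le> W * B / c * weight l t"
        using W[of 1] w[of 1] B c(1) by (intro mult_left_mono c(2)[OF t]) auto
      finally show "w i * \<bar>x t $ i - y t $ i\<bar> \<le> W * B / c * weight l t" by simp
    qed
  qed

  have gx: "continuous_on {0..pi} (\<lambda>t. g t (x t))" if "continuous_on {0..pi} x" for x
  proof -
    have "continuous_on {0..pi} (\<lambda>t. case (t, x t) of (t, x) \<Rightarrow> g t x)"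
      by (rule continuous_on_compose2[OF cont]) (auto intro!: continuous_intros that)
    then show ?thesis by simp
  qed
  \<comment> \<open>With the continuity condition inside the existential, choice yields a total
    operator \<open>T\<close>, specified only on continuous functions.\<close>
  then have "\<forall>x. \<exists>y. continuous_on {0..pi} x \<longrightarrow> dirichlet_solution (mat 1) (\<lambda>t _. g t (x t)) y"
    using dirichlet_linear_exists by blast
  then obtain T where T: "\<And>x. continuous_on {0..pi} x \<Longrightarrow>
      dirichlet_solution (mat 1) (\<lambda>t _. g t (x t)) (T x)"
    by metis
  define X where "X n = (T ^^ n) (\<lambda>_. 0)" for n
  have X_Suc: "X (Suc n) = T (X n)" for n by (simp add: X_def)
  have X_cont: "continuous_on {0..pi} (X n)" for n
  proof (induction n)
    case (Suc n)
    then show ?case unfolding X_Suc by (rule dirichlet_solution_continuous[OF T])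
  qed (simp add: X_def)
  obtain D where D: "D \<ge> 0"
    "\<And>t i. t \<in> {0..pi} \<Longrightarrow> w i * \<bar>X 1 t $ i - X 0 t $ i\<bar> \<le> D * weight l t"
    using weighted_bound[OF X_cont X_cont] by metis
  have step: "w i * \<bar>X (Suc n) t $ i - X n t $ i\<bar> \<le> D * q ^ n * weight l t"
    if "t \<in> {0..pi}" for n t i
    using that
  proof (induction n arbitrary: t i)
    case 0
    then show ?case using D(2)[of t i] by simp
  next
    case (Suc n)
    have "w i * \<bar>T (X (Suc n)) t $ i - T (X n) t $ i\<bar> \<le> q * (D * q ^ n) * weight l t"
      by (rule contr[OF _ _ T[OF X_cont] T[OF X_cont] Suc.IH Suc.prems])
    then show ?case by (simp add: X_Suc mult_ac)
  qed
  \<comment> \<open>The Picard iterates are written as a telescoping series starting from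
    \<open>X 0 = 0\<close>; \<open>step\<close> supplies a geometric majorant for the
    M-test.\<close>
  have "uniformly_convergent_on {0..pi} (\<lambda>n t. \<Sum>k<n. X (Suc k) t - X k t)"
  proof (rule Weierstrass_m_test')
    fix n and t :: real assume t: "t \<in> {0..pi}"
    have "norm (X (Suc n) t - X n t) \<le> (\<Sum>i\<in>UNIV. \<bar>(X (Suc n) t - X n t) $ i\<bar>)"
      by (rule norm_le_l1_cart)
    also have "\<dots> \<le> (\<Sum>i\<in>UNIV. D * q ^ n / w i)"
    proof (rule sum_mono)
      fix i :: 2
      have "w i * \<bar>X (Suc n) t $ i - X n t $ i\<bar> \<le> D * q ^ n * 1"
        using order_trans[OF step[OF t] mult_left_mono[OF wle]] D q by simp
      then show "\<bar>(X (Suc n) t - X n t) $ i\<bar> \<le> D * q ^ n / w i"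
        using w[of i] by (simp add: field_simps)
    qed
    also have "\<dots> = (\<Sum>i\<in>UNIV. D / w i) * q ^ n" by (simp add: sum_distrib_right)
    finally show "norm (X (Suc n) t - X n t) \<le> (\<Sum>i\<in>UNIV. D / w i) * q ^ n" .
  next
    show "summable (\<lambda>n. (\<Sum>i\<in>UNIV. D / w i) * q ^ n)"
      using q by (intro summable_mult summable_geometric) auto
  qed
  moreover have "(\<Sum>k<n. X (Suc k) t - X k t) = X n t" for n t
    using sum_lessThan_telescope[of "\<lambda>k. X k t" n] by (simp add: X_def)
  ultimately obtain x where x: "uniform_limit {0..pi} X x sequentially"
    by (auto simp: uniformly_convergent_on_def)
  have x_cont: "continuous_on {0..pi} x"
    by (rule uniform_limit_theorem[OF _ x]) (auto simp: X_cont)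
  \<comment> \<open>\<open>X (Suc n) = T (X n)\<close> tends to \<open>x\<close> by construction and
    to \<open>T x\<close> because \<open>T\<close> contracts, so the two limits agree.\<close>
  have Tx: "T x t = x t" if t: "t \<in> {0..pi}" for t
  proof (rule LIMSEQ_unique)
    show "(\<lambda>n. X (Suc n) t) \<longlonglongrightarrow> x t"
      using tendsto_uniform_limitI[OF x t] by (rule LIMSEQ_Suc)
    show "(\<lambda>n. X (Suc n) t) \<longlonglongrightarrow> T x t"
    proof (rule vec_tendstoI)
      fix j :: 2
      define W where "W = (\<Sum>i\<in>UNIV. w i)"
      have W: "w i \<le> W" for i unfolding W_def using w less_imp_le by (intro member_le_sum) auto
      have W0: "0 < W" using W[of 1] w[of 1] by linarith
      show "(\<lambda>n. X (Suc n) t $ j) \<longlonglongrightarrow> T x t $ j"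
      proof (rule tendstoI)
        fix \<epsilon> :: real assume \<epsilon>: "\<epsilon> > 0"
        \<comment> \<open>Chosen so that uniform distance below \<delta> gives weighted distance at
          most \<open>\<epsilon> * w j\<close>. The contraction and
          \<open>weight l t \<le> 1\<close> then bound component \<open>j\<close> by
          \<open>q * \<epsilon> < \<epsilon>\<close>.\<close>
        define \<delta> where "\<delta> = \<epsilon> * w j * c / W"
        have \<delta>: "\<delta> > 0" using \<epsilon> w c W0 by (simp add: \<delta>_def)
        have \<delta>W: "W * \<delta> = \<epsilon> * w j * c" using W0 by (simp add: \<delta>_def)
        have "\<forall>\<^sub>F n in sequentially. \<forall>t\<in>{0..pi}. dist (X n t) (x t) < \<delta>"
          using x \<delta> by (auto simp: uniform_limit_iff)
        then show "\<forall>\<^sub>F n in sequentially. dist (X (Suc n) t $ j) (T x t $ j) < \<epsilon>"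
        proof eventually_elim
          case (elim n)
          have "w j * \<bar>T (X n) t $ j - T x t $ j\<bar> \<le> q * (\<epsilon> * w j) * weight l t"
          proof (rule contr[OF _ _ T[OF X_cont] T[OF x_cont] _ t])
            fix t :: real and i assume t: "t \<in> {0..pi}"
            have "w i * \<bar>(X n t - x t) $ i\<bar> \<le> W * \<delta>"
              using W[of i] w[of i] elim[rule_format, OF t] component_le_norm_cart[of "X n t - x t" i]
              by (intro mult_mono) (auto simp: dist_norm)
            also have "\<dots> \<le> \<epsilon> * w j * weight l t"
              unfolding \<delta>W using \<epsilon> w[of j] by (intro mult_left_mono c(2)[OF t]) auto
            finally show "w i * \<bar>X n t $ i - x t $ i\<bar> \<le> \<epsilon> * w j * weight l t" by simp
          qed
          also have "\<dots> \<le> q * (\<epsilon> * w j) * 1"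
            using q \<epsilon> w[of j] by (intro mult_left_mono wle) auto
          also have "\<dots> < 1 * (\<epsilon> * w j)"
            using q \<epsilon> w[of j] by simp
          finally show ?case using w[of j] by (simp add: X_Suc dist_real_def mult.commute)
        qed
      qed
    qed
  qed
  have sol: "dirichlet_solution (mat 1) g (T x)"
    using T[OF x_cont] Tx dirichlet_solution_cong[of "\<lambda>t _. g t (x t)" "T x" g] by simp
  have uniq: "y t = z t" if y: "dirichlet_solution (mat 1) g y"
    and z: "dirichlet_solution (mat 1) g z" and t: "t \<in> {0..pi}" for y z t
  proof -
    obtain D where D: "D \<ge> 0"
      "\<And>t i. t \<in> {0..pi} \<Longrightarrow> w i * \<bar>y t $ i - z t $ i\<bar> \<le> D * weight l t"
      using weighted_bound[OF y[THEN dirichlet_solution_continuous]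
        z[THEN dirichlet_solution_continuous]] by metis
    \<comment> \<open>Both solutions are fixed points, so the contraction estimate can be reapplied
      to the same pair; the bound tends to zero.\<close>
    have it: "w i * \<bar>y t $ i - z t $ i\<bar> \<le> D * q ^ n * weight l t"
      if "t \<in> {0..pi}" for n t i
      using that
    proof (induction n arbitrary: t i)
      case 0
      then show ?case using D(2)[of t i] by simp
    next
      case (Suc n)
      have "w i * \<bar>y t $ i - z t $ i\<bar> \<le> q * (D * q ^ n) * weight l t"
        by (rule contr[OF _ _ y[THEN dirichlet_solution_frozen[THEN iffD1]]
          z[THEN dirichlet_solution_frozen[THEN iffD1]] Suc.IH Suc.prems])
      then show ?case by (simp add: mult_ac)
    qed
    have "y t $ i = z t $ i" for i
    proof -
      have "(\<lambda>n. D * q ^ n * weight l t) \<longlonglongrightarrow> D * 0 * weight l t"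
        using q by (intro tendsto_intros LIMSEQ_power_zero) auto
      then have "w i * \<bar>y t $ i - z t $ i\<bar> \<le> D * 0 * weight l t"
        by (rule LIMSEQ_le_const) (use it[OF t] in auto)
      then show ?thesis using w[of i] by (simp add: mult_le_0_iff)
    qed
    then show ?thesis by (simp add: vec_eq_iff)
  qed
  show ?thesis using sol uniq by blast
qed

section \<open>Kepler motion\<close>

lemma continuous_on_ecc_anomaly_compose:
  fixes h :: "'a::t2_space \<Rightarrow> real"
  assumes "0 \<le> e" "e < 1" "continuous_on S h"
  shows "continuous_on S (\<lambda>x. ecc_anomaly e (h x))"
  by (rule continuous_on_compose2[OF continuous_on_ecc_anomaly]) (use assms in auto)

lemma continuous_on_r_over_a_compose:
  fixes h :: "'a::t2_space \<Rightarrow> real"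
  assumes "0 \<le> e" "e < 1" "continuous_on S h"
  shows "continuous_on S (\<lambda>x. r_over_a e (h x))"
  unfolding r_over_a_def
  by (intro continuous_on_diff continuous_on_mult continuous_on_cos continuous_on_const
      continuous_on_ecc_anomaly_compose assms)

lemma r_over_a_lower_bound:
  assumes "0 \<le> e"
  shows "1 - e \<le> r_over_a e t"
  using mult_left_mono[OF cos_le_one[of "ecc_anomaly e t"] assms] by (simp add: r_over_a_def)

text \<open>The inverse function rule for Kepler's equation, whose derivative in \<open>u\<close> is
  \<open>1 - e * cos u\<close>, that is \<open>r_over_a\<close>.\<close>

lemma DERIV_ecc_anomaly:
  assumes e: "0 \<le> e" "e < 1"
  shows "(ecc_anomaly e has_real_derivative 1 / r_over_a e t) (at t)"
proof -
  have "(ecc_anomaly e has_real_derivative inverse (r_over_a e t)) (at t)"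
  proof (rule DERIV_inverse_function[where f = "\<lambda>u. u - e * sin u" and a = "t - 1" and b = "t + 1"])
    show "((\<lambda>u. u - e * sin u) has_real_derivative r_over_a e t) (at (ecc_anomaly e t))"
      unfolding r_over_a_def by (rule derivative_eq_intros refl | simp)+
    show "r_over_a e t \<noteq> 0" using r_over_a_pos[OF e, of t] by simp
    show "isCont (ecc_anomaly e) t"
      using continuous_on_ecc_anomaly[OF e] by (simp add: continuous_on_eq_continuous_at)
  qed (use ecc_anomaly_kepler[OF e] in auto)
  then show ?thesis by (simp add: inverse_eq_divide)
qed

lemma DERIV_r_over_a:
  assumes e: "0 \<le> e" "e < 1"
  shows "(r_over_a e has_real_derivative e * sin (ecc_anomaly e t) / r_over_a e t) (at t)"
  unfolding r_over_a_def[abs_def]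
  by (rule derivative_eq_intros DERIV_ecc_anomaly[OF e] refl | simp add: r_over_a_def)+

text \<open>\<open>g\<close> is the true anomaly as a function of the eccentric anomaly. Defining it
  as an antiderivative of its expected derivative gives differentiability at once; the polar
  identity is then recovered by a constancy argument.\<close>

lemma true_anomaly_polar_form:
  assumes e: "0 \<le> e" "e < 1"
  obtains g where "g 0 = 0"
    "\<And>u. (g has_real_derivative sqrt (1 - e\<^sup>2) / (1 - e * cos u)) (at u)"
    "\<And>u. complex_of_real (1 - e * cos u) * exp (\<i> * complex_of_real (g u)) =
       Complex (cos u - e) (sqrt (1 - e\<^sup>2) * sin u)"
proof -
  define s where "s = sqrt (1 - e\<^sup>2)"
  have s2: "s\<^sup>2 = 1 - e\<^sup>2" using e by (simp add: s_def abs_square_le_1)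
  have pos: "1 - e * cos u > 0" for u
    using mult_left_mono[OF cos_le_one[of u] e(1)] e(2) by simp
  have "\<exists>G. \<forall>x::real. -\<infinity> < ereal x \<longrightarrow> ereal x < \<infinity> \<longrightarrow>
      (G has_vector_derivative s / (1 - e * cos x)) (at x)"
    by (rule einterval_antiderivative)
      (use pos in \<open>auto intro!: continuous_intros simp: less_imp_neq[THEN not_sym]\<close>)
  then obtain G where G: "\<And>x. (G has_real_derivative s / (1 - e * cos x)) (at x)"
    by (auto simp: has_real_derivative_iff_has_vector_derivative)
  define g where "g u = G u - G 0" for u
  have g: "(g has_real_derivative s / (1 - e * cos u)) (at u)" for u
    unfolding g_def by (rule derivative_eq_intros G refl | simp)+
  have g0: "g 0 = 0" by (simp add: g_def)
  \<comment> \<open>\<open>A + i B\<close> is the quotient of the two sides of the claim; its derivative vanishes.\<close>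
  define A where "A u = ((cos u - e) * cos (g u) + s * sin u * sin (g u)) / (1 - e * cos u)" for u
  define B where "B u = (s * sin u * cos (g u) - (cos u - e) * sin (g u)) / (1 - e * cos u)" for u
  have sin2: "(sin u)\<^sup>2 = 1 - (cos u)\<^sup>2" for u :: real by (simp add: sin_squared_eq)
  have "(A has_real_derivative 0) (at u)" for u
  proof -
    \<comment> \<open>Plain variables for the trigonometric values turn the numerator into a
      polynomial identity using \<open>s\<^sup>2 = 1 - e\<^sup>2\<close>. What remains has the
      factor \<open>1 - (cos u)\<^sup>2 - (sin u)\<^sup>2\<close>, which is zero.\<close>
    define r c d p q where "r = 1 - e * cos u" and "c = cos u" and "d = sin u"
      and "p = cos (g u)" and "q = sin (g u)"
    note gen = \<open>c = cos u\<close>[symmetric] \<open>d = sin u\<close>[symmetric]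
      \<open>p = cos (g u)\<close>[symmetric] \<open>q = sin (g u)\<close>[symmetric]
    have r: "r > 0" using pos by (simp add: \<open>r = _\<close>)
    have "(A has_real_derivative
       ((- sin u * cos (g u) - (cos u - e) * sin (g u) * (s / r) + s * cos u * sin (g u)
         + s * sin u * cos (g u) * (s / r)) * r
         - ((cos u - e) * cos (g u) + s * sin u * sin (g u)) * (e * sin u)) / (r * r)) (at u)"
      unfolding A_def \<open>r = _\<close> using pos[of u]
      by (auto intro!: derivative_eq_intros g simp: algebra_simps)
    also have "(- sin u * cos (g u) - (cos u - e) * sin (g u) * (s / r) + s * cos u * sin (g u)
         + s * sin u * cos (g u) * (s / r)) * r
         = - sin u * cos (g u) * r - (cos u - e) * sin (g u) * s + s * cos u * sin (g u) * r
         + s\<^sup>2 * sin u * cos (g u)"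
      using r by (simp add: algebra_simps power2_eq_square)
    also have "\<dots> - ((cos u - e) * cos (g u) + s * sin u * sin (g u)) * (e * sin u)
      = sin (g u) * s * e * (1 - (cos u)\<^sup>2 - (sin u)\<^sup>2)"
      unfolding s2 \<open>r = _\<close> gen by (simp add: algebra_simps power2_eq_square)
    finally show ?thesis by (simp add: sin2)
  qed
  then have A: "A u = 1" for u
    using DERIV_isconst_all[of A u 0] e by (simp add: A_def g0)
  have "(B has_real_derivative 0) (at u)" for u
  proof -
    define r c d p q where "r = 1 - e * cos u" and "c = cos u" and "d = sin u"
      and "p = cos (g u)" and "q = sin (g u)"
    note gen = \<open>c = cos u\<close>[symmetric] \<open>d = sin u\<close>[symmetric]
      \<open>p = cos (g u)\<close>[symmetric] \<open>q = sin (g u)\<close>[symmetric]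
    have r: "r > 0" using pos by (simp add: \<open>r = _\<close>)
    have "(B has_real_derivative
       ((s * cos u * cos (g u) - s * sin u * sin (g u) * (s / r) + sin u * sin (g u)
         - (cos u - e) * cos (g u) * (s / r)) * r
         - (s * sin u * cos (g u) - (cos u - e) * sin (g u)) * (e * sin u)) / (r * r)) (at u)"
      unfolding B_def \<open>r = _\<close> using pos[of u]
      by (auto intro!: derivative_eq_intros g simp: algebra_simps)
    also have "(s * cos u * cos (g u) - s * sin u * sin (g u) * (s / r) + sin u * sin (g u)
         - (cos u - e) * cos (g u) * (s / r)) * r
         = s * cos u * cos (g u) * r - s\<^sup>2 * sin u * sin (g u) + sin u * sin (g u) * r
         - (cos u - e) * cos (g u) * s"
      using r by (simp add: algebra_simps power2_eq_square)
    also have "\<dots> - (s * sin u * cos (g u) - (cos u - e) * sin (g u)) * (e * sin u)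
      = cos (g u) * s * e * (1 - (cos u)\<^sup>2 - (sin u)\<^sup>2)"
      unfolding s2 \<open>r = _\<close> gen by (simp add: algebra_simps power2_eq_square)
    finally show ?thesis by (simp add: sin2)
  qed
  then have B: "B u = 0" for u
    using DERIV_isconst_all[of B u 0] by (simp add: B_def g0)
  have "complex_of_real (1 - e * cos u) * exp (\<i> * complex_of_real (g u)) =
       Complex (cos u - e) (s * sin u)" for u
  proof -
    \<comment> \<open>\<open>A u = 1\<close> and \<open>B u = 0\<close> are the polar identity
      rotated by \<open>- g u\<close>; multiplying \<open>a\<close> by the cosine or sine of
      \<open>g u\<close> and substituting \<open>b\<close> undoes the rotation.\<close>
    have a: "(cos u - e) * cos (g u) + s * sin u * sin (g u) = 1 - e * cos u"
      using A[of u] pos[of u] by (simp add: A_def)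
    have b: "s * sin u * cos (g u) = (cos u - e) * sin (g u)"
      using B[of u] pos[of u] by (simp add: B_def)
    have "(1 - e * cos u) * cos (g u)
        = (cos u - e) * (cos (g u))\<^sup>2 + (s * sin u * cos (g u)) * sin (g u)"
      unfolding a[symmetric] by (simp add: algebra_simps power2_eq_square)
    also have "\<dots> = (cos u - e) * ((cos (g u))\<^sup>2 + (sin (g u))\<^sup>2)"
      unfolding b by (simp only: distrib_left power2_eq_square mult.assoc)
    finally have re: "(1 - e * cos u) * cos (g u) = cos u - e" by simp
    have "(1 - e * cos u) * sin (g u)
        = ((cos u - e) * sin (g u)) * cos (g u) + s * sin u * (sin (g u))\<^sup>2"
      unfolding a[symmetric] by (simp add: algebra_simps power2_eq_square)
    also have "\<dots> = s * sin u * ((cos (g u))\<^sup>2 + (sin (g u))\<^sup>2)"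
      unfolding b[symmetric] by (simp only: distrib_left power2_eq_square mult.assoc)
    finally have im: "(1 - e * cos u) * sin (g u) = s * sin u" by simp
    show ?thesis
      using re im by (simp add: complex_eq_iff cis_conv_exp[symmetric])
  qed
  then show thesis using that[of g] g0 g unfolding s_def by blast
qed

text \<open>Kepler's second law, from the chain rule. The uniqueness in
  \<open>true_anomaly_ex1\<close> identifies \<open>true_anomaly\<close> with \<open>g\<close>
  composed with the eccentric anomaly.\<close>

lemma DERIV_true_anomaly:
  assumes e: "0 \<le> e" "e < 1"
  shows "(true_anomaly e has_real_derivative sqrt (1 - e\<^sup>2) / (r_over_a e t)\<^sup>2) (at t)"
proof -
  obtain g where g: "g 0 = 0"
    "\<And>u. (g has_real_derivative sqrt (1 - e\<^sup>2) / (1 - e * cos u)) (at u)"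
    "\<And>u. complex_of_real (1 - e * cos u) * exp (\<i> * complex_of_real (g u)) =
       Complex (cos u - e) (sqrt (1 - e\<^sup>2) * sin u)"
    using true_anomaly_polar_form[OF e] by blast
  have deriv: "((\<lambda>t. g (ecc_anomaly e t)) has_real_derivative
      sqrt (1 - e\<^sup>2) / (r_over_a e t)\<^sup>2) (at t)" for t
    using DERIV_chain2[OF g(2) DERIV_ecc_anomaly[OF e]]
    by (simp add: r_over_a_def power2_eq_square)
  have "true_anomaly e = (\<lambda>t. g (ecc_anomaly e t))"
    unfolding true_anomaly_def
  proof (rule the1_equality[OF true_anomaly_ex1[OF e]], intro conjI allI)
    show "continuous_on UNIV (\<lambda>t. g (ecc_anomaly e t))"
      using deriv by (auto intro: DERIV_isCont continuous_at_imp_continuous_on)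
  qed (simp_all only: ecc_anomaly_0[OF e] g r_over_a_def)
  then show ?thesis using deriv by simp
qed

text \<open>This closed form makes the continuity of the forcing term visible.\<close>

lemma deriv2_true_anomaly:
  assumes e: "0 \<le> e" "e < 1"
  shows "deriv (deriv (true_anomaly e)) t =
    - 2 * sqrt (1 - e\<^sup>2) * e * sin (ecc_anomaly e t) / (r_over_a e t) ^ 4"
proof -
  have "deriv (true_anomaly e) = (\<lambda>t. sqrt (1 - e\<^sup>2) / (r_over_a e t)\<^sup>2)"
    using DERIV_imp_deriv[OF DERIV_true_anomaly[OF e]] by auto
  moreover have "((\<lambda>t. sqrt (1 - e\<^sup>2) / (r_over_a e t)\<^sup>2) has_real_derivative
    - 2 * sqrt (1 - e\<^sup>2) * e * sin (ecc_anomaly e t) / (r_over_a e t) ^ 4) (at t)"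
    using r_over_a_pos[OF e, of t]
    by (auto intro!: derivative_eq_intros DERIV_r_over_a[OF e]
        simp: field_simps power2_eq_square power4_eq_xxxx)
  ultimately show ?thesis by (simp add: DERIV_imp_deriv)
qed

section \<open>The spin-spin force\<close>

lemma spin_spin_F_nth:
  "spin_spin_F e C\<^sub>1 C\<^sub>2 \<Lambda>\<^sub>1 \<Lambda>\<^sub>2 \<Lambda> t x $ 1 =
     \<Lambda>\<^sub>1 * sin (x $ 1) / r_over_a e t ^ 3 +
     (\<Sum>p\<in>\<Xi>. of_int (fst p) * (\<Lambda> (fst p) (snd p) *
       sin (of_int (fst p) * x $ 1 + of_int (snd p) * x $ 2))) / r_over_a e t ^ 5 +
     2 * deriv (deriv (true_anomaly e)) t * C\<^sub>1"
  "spin_spin_F e C\<^sub>1 C\<^sub>2 \<Lambda>\<^sub>1 \<Lambda>\<^sub>2 \<Lambda> t x $ 2 =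
     \<Lambda>\<^sub>2 * sin (x $ 2) / r_over_a e t ^ 3 +
     (\<Sum>p\<in>\<Xi>. of_int (snd p) * (\<Lambda> (fst p) (snd p) *
       sin (of_int (fst p) * x $ 1 + of_int (snd p) * x $ 2))) / r_over_a e t ^ 5 +
     2 * deriv (deriv (true_anomaly e)) t * C\<^sub>2"
  by (simp_all add: spin_spin_F_def split_beta power_one_over mult_ac)

lemma abs_sin_diff_le: "\<bar>sin a - sin b\<bar> \<le> \<bar>a - b\<bar>" for a b :: real
proof -
  have "norm (sin a - sin b) \<le> 1 * norm (a - b)"
    by (rule field_differentiable_bound[of UNIV sin cos])
      (auto intro!: derivative_eq_intros)
  then show ?thesis by simp
qed

text \<open>One row of the force for either body: \<open>a\<close> is its own angle,
  \<open>c\<close> holds the coupling coefficients and \<open>k p\<close> is the entry of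
  \<open>p\<close> multiplying them. Since the sine is 1-Lipschitz and each difference is at most
  \<open>D\<close> over its weight, the row sum of the Jacobian bound appears, with \<open>r\<close>
  replaced by its lower bound \<rho>.\<close>

lemma weighted_force_lipschitz:
  fixes \<rho> r L D w w\<^sub>1 w\<^sub>2 a a' x x' y y' :: real and c k :: "int \<times> int \<Rightarrow> real"
  assumes \<rho>: "0 < \<rho>" "\<rho> \<le> r" and L: "0 \<le> L" and c: "\<And>p. p \<in> S \<Longrightarrow> 0 \<le> c p"
    and w: "w > 0" "w\<^sub>1 > 0" "w\<^sub>2 > 0"
    and D: "w * \<bar>a - a'\<bar> \<le> D" "w\<^sub>1 * \<bar>x - x'\<bar> \<le> D" "w\<^sub>2 * \<bar>y - y'\<bar> \<le> D"
  shows "\<bar>(L * sin a / r ^ 3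
        + (\<Sum>p\<in>S. k p * (c p * sin (of_int (fst p) * x + of_int (snd p) * y))) / r ^ 5)
      - (L * sin a' / r ^ 3
        + (\<Sum>p\<in>S. k p * (c p * sin (of_int (fst p) * x' + of_int (snd p) * y'))) / r ^ 5)\<bar>
    \<le> 1 / \<rho> ^ 3 * (L / w + 1 / \<rho>\<^sup>2 *
        (\<Sum>p\<in>S. \<bar>k p\<bar> * (of_int \<bar>fst p\<bar> / w\<^sub>1 + of_int \<bar>snd p\<bar> / w\<^sub>2) * c p)) * D"
    (is "\<bar>(L * sin a / r ^ 3 + ?S / r ^ 5) - (L * sin a' / r ^ 3 + ?S' / r ^ 5)\<bar> \<le> _")
proof -
  define M where "M = (\<Sum>p\<in>S. \<bar>k p\<bar> * (of_int \<bar>fst p\<bar> / w\<^sub>1 + of_int \<bar>snd p\<bar> / w\<^sub>2) * c p)"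
  have bound: "\<bar>u - u'\<bar> \<le> D / v" if "v * \<bar>u - u'\<bar> \<le> D" "v > 0" for u u' v :: real
    using that by (simp add: field_simps)
  have "0 \<le> w * \<bar>a - a'\<bar>" using w by simp
  then have D0: "0 \<le> D" using D(1) by linarith
  have M0: "0 \<le> M" unfolding M_def using w c by (intro sum_nonneg) auto
  have "\<bar>?S - ?S'\<bar> \<le> (\<Sum>p\<in>S. \<bar>k p * (c p * sin (of_int (fst p) * x + of_int (snd p) * y))
      - k p * (c p * sin (of_int (fst p) * x' + of_int (snd p) * y'))\<bar>)"
    unfolding sum_subtractf[symmetric] by (rule sum_abs)
  also have "\<dots> \<le> (\<Sum>p\<in>S. \<bar>k p\<bar> * (of_int \<bar>fst p\<bar> / w\<^sub>1 + of_int \<bar>snd p\<bar> / w\<^sub>2) * c p * D)"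
  proof (rule sum_mono)
    fix p assume p: "p \<in> S"
    obtain m n where mn: "p = (m, n)" by fastforce
    have "\<bar>sin (of_int m * x + of_int n * y) - sin (of_int m * x' + of_int n * y')\<bar>
        \<le> \<bar>(of_int m * x + of_int n * y) - (of_int m * x' + of_int n * y')\<bar>"
      by (rule abs_sin_diff_le)
    also have "\<dots> = \<bar>of_int m * (x - x') + of_int n * (y - y')\<bar>" by (simp add: algebra_simps)
    also have "\<dots> \<le> of_int \<bar>m\<bar> * \<bar>x - x'\<bar> + of_int \<bar>n\<bar> * \<bar>y - y'\<bar>"
      by (rule order_trans[OF abs_triangle_ineq]) (simp add: abs_mult)
    also have "\<dots> \<le> of_int \<bar>m\<bar> * (D / w\<^sub>1) + of_int \<bar>n\<bar> * (D / w\<^sub>2)"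
      by (intro add_mono mult_left_mono bound D w) auto
    also have "\<dots> = (of_int \<bar>m\<bar> / w\<^sub>1 + of_int \<bar>n\<bar> / w\<^sub>2) * D" by (simp add: algebra_simps)
    finally have "\<bar>k p\<bar> * c p * \<bar>sin (of_int m * x + of_int n * y) - sin (of_int m * x' + of_int n * y')\<bar>
        \<le> \<bar>k p\<bar> * c p * ((of_int \<bar>m\<bar> / w\<^sub>1 + of_int \<bar>n\<bar> / w\<^sub>2) * D)"
      using c[OF p] by (intro mult_left_mono) auto
    moreover have "\<bar>k p * (c p * sin (of_int m * x + of_int n * y))
        - k p * (c p * sin (of_int m * x' + of_int n * y'))\<bar>
      = \<bar>k p\<bar> * c p * \<bar>sin (of_int m * x + of_int n * y) - sin (of_int m * x' + of_int n * y')\<bar>"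
      using c[OF p] by (simp add: abs_mult flip: right_diff_distrib)
    ultimately show "\<bar>k p * (c p * sin (of_int (fst p) * x + of_int (snd p) * y))
        - k p * (c p * sin (of_int (fst p) * x' + of_int (snd p) * y'))\<bar>
      \<le> \<bar>k p\<bar> * (of_int \<bar>fst p\<bar> / w\<^sub>1 + of_int \<bar>snd p\<bar> / w\<^sub>2) * c p * D"
      by (simp add: mn mult_ac)
  qed
  also have "\<dots> = M * D" by (simp add: M_def sum_distrib_right)
  finally have sums: "\<bar>?S - ?S'\<bar> \<le> M * D" .
  have sin: "L * \<bar>sin a - sin a'\<bar> \<le> L * (D / w)"
    by (intro mult_left_mono L order_trans[OF abs_sin_diff_le] bound D w)
  have "\<bar>(L * sin a / r ^ 3 + ?S / r ^ 5) - (L * sin a' / r ^ 3 + ?S' / r ^ 5)\<bar>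
      = \<bar>L * (sin a - sin a') / r ^ 3 + (?S - ?S') / r ^ 5\<bar>"
    by (simp add: algebra_simps diff_divide_distrib)
  also have "\<dots> \<le> L * \<bar>sin a - sin a'\<bar> / r ^ 3 + \<bar>?S - ?S'\<bar> / r ^ 5"
    using \<rho> L by (intro order_trans[OF abs_triangle_ineq]) (simp add: abs_mult)
  also have "\<dots> \<le> L * (D / w) / \<rho> ^ 3 + M * D / \<rho> ^ 5"
    using \<rho> L D0 M0 w by (intro add_mono frac_le sums sin power_mono) auto
  also have "\<dots> = 1 / \<rho> ^ 3 * (L / w + 1 / \<rho>\<^sup>2 * M) * D"
  proof -
    have "\<rho> ^ 5 = \<rho> ^ 3 * \<rho>\<^sup>2" by (simp flip: power_add)
    then show ?thesis by (simp add: algebra_simps)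
  qed
  finally show ?thesis unfolding M_def .
qed

lemma continuous_on_spin_spin_F_nth:
  assumes e: "0 \<le> e" "e < 1"
  shows "continuous_on S (\<lambda>p. spin_spin_F e C\<^sub>1 C\<^sub>2 \<Lambda>\<^sub>1 \<Lambda>\<^sub>2 \<Lambda> (fst p) (snd p) $ i)"
proof -
  have r: "r_over_a e t ^ n \<noteq> 0" for t n using r_over_a_pos[OF e, of t] by simp
  note [continuous_intros] = continuous_on_r_over_a_compose[OF e] continuous_on_ecc_anomaly_compose[OF e]
  have "i = 1 \<or> i = 2" by (rule exhaust_2)
  then show ?thesis
  proof
    assume "i = 1"
    then show ?thesis
      by (simp only: spin_spin_F_nth deriv2_true_anomaly[OF e]) (intro continuous_intros ballI r)
  next
    assume "i = 2"
    then show ?thesis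
      by (simp only: spin_spin_F_nth deriv2_true_anomaly[OF e]) (intro continuous_intros ballI r)
  qed
qed

lemma diag2_equation_iff:
  assumes "C\<^sub>1 \<noteq> 0" "C\<^sub>2 \<noteq> 0"
  shows "diag2 C\<^sub>1 C\<^sub>2 *v y + z = 0 \<longleftrightarrow>
    mat 1 *v y + (\<chi> i. z $ i / (if i = 1 then C\<^sub>1 else C\<^sub>2)) = 0"
proof -
  have eq: "c * a + b = 0 \<longleftrightarrow> a + b / c = 0" if "c \<noteq> 0" for a b c :: real
    using that by (simp add: add_eq_0_iff2 field_simps)
  show ?thesis
    unfolding matrix_vector_mul_lid
    using assms by (simp add: vec_eq_iff forall_2 diag2_def matrix_vector_mult_def sum_2 eq)
qed


theorem theorem1:
  fixes e C\<^sub>1 C\<^sub>2 \<Lambda>\<^sub>1 \<Lambda>\<^sub>2 \<alpha>\<^sub>1 \<alpha>\<^sub>2 :: real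
    and \<Lambda> :: "int \<Rightarrow> int \<Rightarrow> real"
  assumes "0 \<le> e" "e < 1"
    and "C\<^sub>1 > 0" "C\<^sub>2 > 0" "C\<^sub>1 + C\<^sub>2 = 1"
    and "\<Lambda>\<^sub>1 > 0" "\<Lambda>\<^sub>2 > 0"
    and "\<And>m\<^sub>1 m\<^sub>2. (m\<^sub>1, m\<^sub>2) \<in> \<Xi> \<Longrightarrow> \<Lambda> m\<^sub>1 m\<^sub>2 > 0"
    and "\<And>m\<^sub>1 m\<^sub>2. (m\<^sub>1, m\<^sub>2) \<in> \<Xi> \<Longrightarrow> \<Lambda> m\<^sub>1 m\<^sub>2 = \<Lambda> (- m\<^sub>1) (- m\<^sub>2)"
    and "\<alpha>\<^sub>1 * (\<Lambda>\<^sub>1 / C\<^sub>1) = 1 / (1 - e)\<^sup>2 *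
      (\<Sum>(m\<^sub>1, m\<^sub>2)\<in>\<Xi>. ((of_int m\<^sub>1)\<^sup>2 / C\<^sub>1 + of_int \<bar>m\<^sub>1 * m\<^sub>2\<bar> / sqrt (C\<^sub>1 * C\<^sub>2)) * \<Lambda> m\<^sub>1 m\<^sub>2)"
    and "\<alpha>\<^sub>2 * (\<Lambda>\<^sub>2 / C\<^sub>2) = 1 / (1 - e)\<^sup>2 *
      (\<Sum>(m\<^sub>1, m\<^sub>2)\<in>\<Xi>. ((of_int m\<^sub>2)\<^sup>2 / C\<^sub>2 + of_int \<bar>m\<^sub>1 * m\<^sub>2\<bar> / sqrt (C\<^sub>1 * C\<^sub>2)) * \<Lambda> m\<^sub>1 m\<^sub>2)"
    and "1 > 1 / (1 - e) ^ 3 * max (\<Lambda>\<^sub>1 / C\<^sub>1 * (1 + \<alpha>\<^sub>1)) (\<Lambda>\<^sub>2 / C\<^sub>2 * (1 + \<alpha>\<^sub>2))"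
  shows "\<exists>\<Theta>. dirichlet_solution (diag2 C\<^sub>1 C\<^sub>2) (spin_spin_F e C\<^sub>1 C\<^sub>2 \<Lambda>\<^sub>1 \<Lambda>\<^sub>2 \<Lambda>) \<Theta> \<and>
    (\<forall>\<Psi>. dirichlet_solution (diag2 C\<^sub>1 C\<^sub>2) (spin_spin_F e C\<^sub>1 C\<^sub>2 \<Lambda>\<^sub>1 \<Lambda>\<^sub>2 \<Lambda>) \<Psi> \<longrightarrow>
       (\<forall>t\<in>{0..pi}. \<Psi> t = \<Theta> t))"
proof -
  define C :: "2 \<Rightarrow> real" where "C i = (if i = 1 then C\<^sub>1 else C\<^sub>2)" for i
  have C: "C i > 0" for i using assms(3,4) by (simp add: C_def)
  have C12: "C 1 = C\<^sub>1" "C 2 = C\<^sub>2" by (simp_all add: C_def)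
  define F where "F = spin_spin_F e C\<^sub>1 C\<^sub>2 \<Lambda>\<^sub>1 \<Lambda>\<^sub>2 \<Lambda>"
  define g :: "real \<Rightarrow> real^2 \<Rightarrow> real^2" where "g t x = (\<chi> i. F t x $ i / C i)" for t x
  \<comment> \<open>The coupling part of row \<open>j\<close> in the weights
    \<open>sqrt (C i)\<close>; a further division by \<open>sqrt (C j)\<close> yields the sum that
    defines \<alpha>, as \<open>summand\<close> shows term by term.\<close>
  define S where "S j = (\<Sum>p\<in>\<Xi>. of_int \<bar>if j = 1 then fst p else snd p\<bar>
    * (of_int \<bar>fst p\<bar> / sqrt C\<^sub>1 + of_int \<bar>snd p\<bar> / sqrt C\<^sub>2) * \<Lambda> (fst p) (snd p))" for j :: 2
  define K where "K = 1 / (1 - e) ^ 3 * max (\<Lambda>\<^sub>1 / C\<^sub>1 * (1 + \<alpha>\<^sub>1)) (\<Lambda>\<^sub>2 / C\<^sub>2 * (1 + \<alpha>\<^sub>2))"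
  have \<Lambda>0: "\<And>p. p \<in> \<Xi> \<Longrightarrow> 0 \<le> \<Lambda> (fst p) (snd p)"
    using assms(8) by (metis less_imp_le prod.collapse)
  have summand: "((of_int m)\<^sup>2 / C\<^sub>1 + of_int \<bar>m * n\<bar> / sqrt (C\<^sub>1 * C\<^sub>2)) * c
      = of_int \<bar>m\<bar> * (of_int \<bar>m\<bar> / sqrt C\<^sub>1 + of_int \<bar>n\<bar> / sqrt C\<^sub>2) * c / sqrt C\<^sub>1"
    "((of_int n)\<^sup>2 / C\<^sub>2 + of_int \<bar>m * n\<bar> / sqrt (C\<^sub>1 * C\<^sub>2)) * c
      = of_int \<bar>n\<bar> * (of_int \<bar>m\<bar> / sqrt C\<^sub>1 + of_int \<bar>n\<bar> / sqrt C\<^sub>2) * c / sqrt C\<^sub>2" for m n c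
  proof -
    have "((of_int m)\<^sup>2 / (a * a) + of_int \<bar>m * n\<bar> / (a * b)) * c
        = of_int \<bar>m\<bar> * (of_int \<bar>m\<bar> / a + of_int \<bar>n\<bar> / b) * c / a"
      for m n and a b :: real
      by (simp add: abs_mult power2_eq_square distrib_left distrib_right add_divide_distrib mult_ac)
    from this[of m "sqrt C\<^sub>1" n "sqrt C\<^sub>2"] this[of n "sqrt C\<^sub>2" m "sqrt C\<^sub>1"]
    show "((of_int m)\<^sup>2 / C\<^sub>1 + of_int \<bar>m * n\<bar> / sqrt (C\<^sub>1 * C\<^sub>2)) * c
      = of_int \<bar>m\<bar> * (of_int \<bar>m\<bar> / sqrt C\<^sub>1 + of_int \<bar>n\<bar> / sqrt C\<^sub>2) * c / sqrt C\<^sub>1"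
      "((of_int n)\<^sup>2 / C\<^sub>2 + of_int \<bar>m * n\<bar> / sqrt (C\<^sub>1 * C\<^sub>2)) * c
      = of_int \<bar>n\<bar> * (of_int \<bar>m\<bar> / sqrt C\<^sub>1 + of_int \<bar>n\<bar> / sqrt C\<^sub>2) * c / sqrt C\<^sub>2"
      using assms(3,4) by (simp_all add: real_sqrt_mult mult.commute add.commute)
  qed
  have S0: "0 \<le> S j" for j
    unfolding S_def using assms(3,4) \<Lambda>0 by (intro sum_nonneg mult_nonneg_nonneg) auto
  have S1: "\<alpha>\<^sub>1 * (\<Lambda>\<^sub>1 / C\<^sub>1) = 1 / (1 - e)\<^sup>2 * (S 1 / sqrt C\<^sub>1)"
    unfolding assms(10) S_def sum_divide_distrib
    by (intro arg_cong[where f = "(*) _"] sum.cong refl)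
      (simp add: split_beta summand del: of_int_abs of_int_mult)
  have S2: "\<alpha>\<^sub>2 * (\<Lambda>\<^sub>2 / C\<^sub>2) = 1 / (1 - e)\<^sup>2 * (S 2 / sqrt C\<^sub>2)"
    unfolding assms(11) S_def sum_divide_distrib
    by (intro arg_cong[where f = "(*) _"] sum.cong refl)
      (simp add: split_beta summand del: of_int_abs of_int_mult)
  have K1: "1 / (1 - e) ^ 3 * (\<Lambda>\<^sub>1 / C\<^sub>1 + 1 / (1 - e)\<^sup>2 * (S 1 / sqrt C\<^sub>1)) \<le> K"
    and K2: "1 / (1 - e) ^ 3 * (\<Lambda>\<^sub>2 / C\<^sub>2 + 1 / (1 - e)\<^sup>2 * (S 2 / sqrt C\<^sub>2)) \<le> K"
  proof -
    have "a + \<alpha> * a \<le> max (a * (1 + \<alpha>)) b" "a + \<alpha> * a \<le> max b (a * (1 + \<alpha>))" for a b \<alpha> :: real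
      by (simp_all add: distrib_left mult.commute)
    moreover have "0 \<le> 1 / (1 - e) ^ 3" using assms(2) by simp
    ultimately show "1 / (1 - e) ^ 3 * (\<Lambda>\<^sub>1 / C\<^sub>1 + 1 / (1 - e)\<^sup>2 * (S 1 / sqrt C\<^sub>1)) \<le> K"
      "1 / (1 - e) ^ 3 * (\<Lambda>\<^sub>2 / C\<^sub>2 + 1 / (1 - e)\<^sup>2 * (S 2 / sqrt C\<^sub>2)) \<le> K"
      unfolding K_def S1[symmetric] S2[symmetric] by (blast intro: mult_left_mono)+
  qed
  \<comment> \<open>Nonnegativity of \<open>K\<close> is read off from the left side of
    \<open>K1\<close>, where every term is nonnegative.\<close>
  have "0 \<le> 1 / (1 - e) ^ 3 * (\<Lambda>\<^sub>1 / C\<^sub>1 + 1 / (1 - e)\<^sup>2 * (S 1 / sqrt C\<^sub>1))"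
    using assms(2,3,6) S0[of 1] by simp
  then have K: "0 \<le> K" "K < 1" using K1 assms(12) unfolding K_def by linarith+
  have lip: "sqrt (C j) * \<bar>g t x $ j - g t y $ j\<bar> \<le> K * D"
    if t: "t \<in> {0..pi}" and D: "\<And>i. sqrt (C i) * \<bar>x $ i - y $ i\<bar> \<le> D"
    for t D j and x y :: "real^2"
  proof -
    have "0 \<le> sqrt (C 1) * \<bar>x $ 1 - y $ 1\<bar>" using C[of 1] by simp
    then have D0: "0 \<le> D" using D[of 1] by linarith
    have D1: "sqrt C\<^sub>1 * \<bar>x $ 1 - y $ 1\<bar> \<le> D" and D2: "sqrt C\<^sub>2 * \<bar>x $ 2 - y $ 2\<bar> \<le> D"
      using D[of 1] D[of 2] by (simp_all add: C12)
    have \<rho>: "0 < 1 - e" "1 - e \<le> r_over_a e t"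
      using assms(1,2) r_over_a_lower_bound by auto
    have sqrt0: "0 < sqrt C\<^sub>1" "0 < sqrt C\<^sub>2" using assms(3,4) by auto
    \<comment> \<open>Dividing by \<open>C j\<close> and weighting by \<open>sqrt (C j)\<close>
      leaves one factor \<open>1 / sqrt (C j)\<close>, which \<open>final\<close> absorbs to reach
      the expressions in \<open>K1\<close> and \<open>K2\<close>.\<close>
    have scale: "sqrt (C j) * \<bar>g t x $ j - g t y $ j\<bar> = \<bar>F t x $ j - F t y $ j\<bar> / sqrt (C j)"
    proof -
      have "\<bar>g t x $ j - g t y $ j\<bar> = \<bar>F t x $ j - F t y $ j\<bar> / (sqrt (C j) * sqrt (C j))"
        using C[of j] by (simp add: g_def flip: diff_divide_distrib)
      moreover have "s * (z / (s * s)) = z / s" for s z :: real by simp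
      ultimately show ?thesis by metis
    qed
    have final: "\<bar>F t x $ j - F t y $ j\<bar> / sqrt c \<le> K * D"
      if "\<bar>F t x $ j - F t y $ j\<bar> \<le> 1 / (1 - e) ^ 3 * (L / sqrt c + 1 / (1 - e)\<^sup>2 * S j) * D"
        and "1 / (1 - e) ^ 3 * (L / c + 1 / (1 - e)\<^sup>2 * (S j / sqrt c)) \<le> K" and c: "c > 0" for L c
    proof -
      have "\<bar>F t x $ j - F t y $ j\<bar> / sqrt c
          \<le> 1 / (1 - e) ^ 3 * (L / sqrt c + 1 / (1 - e)\<^sup>2 * S j) * D / sqrt c"
        using that by (intro divide_right_mono) auto
      also have "\<dots> = 1 / (1 - e) ^ 3 * (L / (sqrt c * sqrt c) + 1 / (1 - e)\<^sup>2 * (S j / sqrt c)) * D"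
        by (simp add: algebra_simps add_divide_distrib)
      also have "\<dots> \<le> K * D" using that D0 by (intro mult_right_mono) auto
      finally show ?thesis .
    qed
    have "j = 1 \<or> j = 2" by (rule exhaust_2)
    then have "\<bar>F t x $ j - F t y $ j\<bar> / sqrt (C j) \<le> K * D"
    proof
      assume j: "j = 1"
      \<comment> \<open>The term with the second derivative of the true anomaly depends on time
        alone and cancels in the difference.\<close>
      have "\<bar>F t x $ 1 - F t y $ 1\<bar> \<le> 1 / (1 - e) ^ 3 * (\<Lambda>\<^sub>1 / sqrt C\<^sub>1 + 1 / (1 - e)\<^sup>2 * S 1) * D"
        using weighted_force_lipschitz[OF \<rho>, of \<Lambda>\<^sub>1 \<Xi> "\<lambda>p. \<Lambda> (fst p) (snd p)" "sqrt C\<^sub>1" "sqrt C\<^sub>1" "sqrt C\<^sub>2"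
            "x $ 1" "y $ 1" D "x $ 1" "y $ 1" "x $ 2" "y $ 2" "\<lambda>p. of_int (fst p)"]
          assms(6) \<Lambda>0 sqrt0 D1 D2
        by (simp add: F_def spin_spin_F_nth S_def)
      then show ?thesis using final[of \<Lambda>\<^sub>1 C\<^sub>1] K1 assms(3) unfolding j C12 by blast
    next
      assume j: "j = 2"
      have "\<bar>F t x $ 2 - F t y $ 2\<bar> \<le> 1 / (1 - e) ^ 3 * (\<Lambda>\<^sub>2 / sqrt C\<^sub>2 + 1 / (1 - e)\<^sup>2 * S 2) * D"
        using weighted_force_lipschitz[OF \<rho>, of \<Lambda>\<^sub>2 \<Xi> "\<lambda>p. \<Lambda> (fst p) (snd p)" "sqrt C\<^sub>2" "sqrt C\<^sub>1" "sqrt C\<^sub>2"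
            "x $ 2" "y $ 2" D "x $ 1" "y $ 1" "x $ 2" "y $ 2" "\<lambda>p. of_int (snd p)"]
          assms(7) \<Lambda>0 sqrt0 D1 D2
        by (simp add: F_def spin_spin_F_nth S_def)
      then show ?thesis using final[of \<Lambda>\<^sub>2 C\<^sub>2] K2 assms(4) unfolding j C12 by blast
    qed
    then show ?thesis unfolding scale .
  qed
  have cont: "continuous_on ({0..pi} \<times> UNIV) (\<lambda>(t, x). g t x)"
    unfolding split_beta g_def F_def using C
    by (intro continuous_on_vec_lambda continuous_on_divide continuous_on_const
        continuous_on_spin_spin_F_nth assms(1,2)) (simp add: less_imp_neq[THEN not_sym])
  \<comment> \<open>The two problems have the same solutions, so existence and uniqueness
    transfer.\<close>
  have "dirichlet_solution (diag2 C\<^sub>1 C\<^sub>2) F \<Theta> \<longleftrightarrow> dirichlet_solution (mat 1) g \<Theta>" for \<Theta>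
    using assms(3,4) unfolding dirichlet_solution_def g_def C_def
    by (subst diag2_equation_iff) auto
  moreover have "\<exists>x. dirichlet_solution (mat 1) g x \<and>
      (\<forall>y. dirichlet_solution (mat 1) g y \<longrightarrow> (\<forall>t\<in>{0..pi}. y t = x t))"
    by (rule dirichlet_unique_solution[OF cont _ K, where w = "\<lambda>i. sqrt (C i)"])
      (use C lip in auto)
  ultimately show ?thesis unfolding F_def by blast
qed

end
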